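(* Let $\lambda$ be a regular uncountable cardinal. For $p\in\mathbb{Q}^0_\lambda$ let $f_p\in{}^\lambda\lambda$ be the function such that for every $\alpha<\lambda$, $f_p(\alpha)\in C^p$ and the order type of $C^p\cap f_p(\alpha)$ is $\omega\cdot\alpha+\omega$. (1) Suppose $G^*_0\subseteq\mathbb{Q}^0_\lambda$ is $({<}\aleph_1)$-directed with respect to $\le^0$ and $\mathrm{fil}(G^*_0)$ is a weakly reasonable ultrafilter. Then $\{f_p:p\in G^*_0\}$ is a dominating family in ${}^\lambda\lambda$. (2) Suppose $G^*_1\subseteq\mathbb{Q}^0_\lambda$ is directed with respect to $\le^0$ and $\mathrm{fil}(G^*_1)$ is a weakly reasonable ultrafilter on $\lambda$. Then $\{f_p:p\in G^*_1\}$ is a club-dominating family in ${}^\lambda\lambda$.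
   Context: $\mathbb{Q}^0_\lambda$ is the set of all tuples $p=(C^p,\langle Z^p_\delta:\delta\in C^p\rangle,\langle d^p_\delta:\delta\in C^p\rangle)$ such that $C^p$ is a club of $\lambda$ consisting of limit ordinals and, for $\delta\in C^p$, $Z^p_\delta=[\delta,\min(C^p\setminus(\delta+1)))$ and $d^p_\delta$ is an ultrafilter on $Z^p_\delta$. For $q\in\mathbb{Q}^0_\lambda$, $\mathrm{fil}(q)=\{A\subseteq\lambda:\exists\varepsilon<\lambda\ \forall\delta\in C^q\setminus\varepsilon\ (A\cap Z^q_\delta\in d^q_\delta)\}$, and for $G\subseteq\mathbb{Q}^0_\lambda$, $\mathrm{fil}(G)=\bigcup_{p\in G}\mathrm{fil}(p)$. $p\le^0 q$ iff $\mathrm{fil}(p)\subseteq\mathrm{fil}(q)$. $({<}\aleph_1)$-directed means every countable subset has a $\le^0$-upper bound in the set; directed means every finite subset does. A uniform ultrafilter on $\lambda$ is one all of whose members have size $\lambda$; $\mathcal{F}_\lambda$ is the family of non-decreasing unbounded functions $\lambda\to\lambda$; a uniform ultrafilter $D$ on $\lambda$ is weakly reasonable if for every $f\in\mathcal{F}_\lambda$ there is a club $C$ of $\lambda$ with $\bigcup\{[\delta,\delta+f(\delta)):\delta\in C\}\notin D$. $\mathcal{F}\subseteq{}^\lambda\lambda$ is dominating if for every $g\in{}^\lambda\lambda$ there are $f\in\mathcal{F}$ and $\alpha<\lambda$ with $g(\beta)<f(\beta)$ for all $\beta>\alpha$. $\mathcal{F}$ is club-dominating if for every $g\in{}^\lambda\lambda$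 there is $f\in\mathcal{F}$ such that $\{\beta<\lambda:g(\beta)\ge f(\beta)\}$ is non-stationary in $\lambda$. *)

theory Defs
  imports "HOL-Library.Countable_Set" "HOL-Library.FuncSet"
begin

unbundle cardinal_syntax

(* The cardinal \<lambda> is represented by a type 'a of class wellorder whose order is a regular
   uncountable cardinal; the elements of 'a are the ordinals below \<lambda>, and the ordinal
   \<alpha> < \<lambda>, as a set of ordinals, is {..<\<alpha>}. *)

definition le_rel :: "('a::wellorder) set \<Rightarrow> 'a rel" where
  "le_rel A = relation_of (\<le>) A"

definition regular_uncountable_cardinal :: "'a rel \<Rightarrow> bool" where
  "regular_uncountable_cardinal r \<longleftrightarrow> Card_order r \<and> regularCard r \<and> natLeq <o r"


section \<open>Ordinals below \<open>\<lambda>\<close>\<close>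

(* Limit ordinals are nonzero. *)
definition is_limit :: "'a::wellorder \<Rightarrow> bool" where
  "is_limit \<delta> \<longleftrightarrow> (\<exists>\<alpha>. \<alpha> < \<delta>) \<and> (\<forall>\<alpha><\<delta>. \<exists>\<beta>. \<alpha> < \<beta> \<and> \<beta> < \<delta>)"

definition omega :: "'a::wellorder" where
  "omega = (LEAST \<delta>. is_limit \<delta>)"

(* Ordinal sum and product by transfinite recursion on the second argument, with the zero,
   successor and limit clauses merged:
     \<alpha> + \<beta> = sup ({\<alpha>} \<union> {(\<alpha> + \<beta>') + 1 | \<beta>' < \<beta>}),   \<alpha> \<cdot> \<beta> = sup {\<alpha> \<cdot> \<beta>' + \<alpha> | \<beta>' < \<beta>}.
   The suprema exist in an infinite regular cardinal. *)
function oadd :: "'a::wellorder \<Rightarrow> 'a \<Rightarrow> 'a" where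
  "oadd \<alpha> \<beta> = (LEAST \<gamma>. \<alpha> \<le> \<gamma> \<and> (\<forall>\<beta>'\<in>{..<\<beta>}. oadd \<alpha> \<beta>' < \<gamma>))"
  by pat_completeness auto
termination
  by (relation "inv_image {(x, y). x < y} snd") (simp_all add: wf_inv_image wf)

declare oadd.simps [simp del]

function omult :: "'a::wellorder \<Rightarrow> 'a \<Rightarrow> 'a" where
  "omult \<alpha> \<beta> = (LEAST \<gamma>. \<forall>\<beta>'\<in>{..<\<beta>}. oadd (omult \<alpha> \<beta>') \<alpha> \<le> \<gamma>)"
  by pat_completeness auto
termination
  by (relation "inv_image {(x, y). x < y} snd") (simp_all add: wf_inv_image wf)

declare omult.simps [simp del]

definition has_order_type :: "('a::wellorder) set \<Rightarrow> 'a \<Rightarrow> bool" where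
  "has_order_type A \<alpha> \<longleftrightarrow> le_rel A =o le_rel {..<\<alpha>}"

definition club :: "('a::wellorder) set \<Rightarrow> bool" where
  "club C \<longleftrightarrow> (\<forall>\<alpha>. \<exists>\<beta>\<in>C. \<alpha> < \<beta>) \<and>
     (\<forall>\<delta>. is_limit \<delta> \<and> (\<forall>\<alpha><\<delta>. \<exists>\<beta>\<in>C. \<alpha> < \<beta> \<and> \<beta> < \<delta>) \<longrightarrow> \<delta> \<in> C)"

definition stationary :: "('a::wellorder) set \<Rightarrow> bool" where
  "stationary S \<longleftrightarrow> (\<forall>C. club C \<longrightarrow> S \<inter> C \<noteq> {})"


section \<open>Ultrafilters\<close>

definition ultrafilter_on :: "'a set \<Rightarrow> 'a set set \<Rightarrow> bool" where
  "ultrafilter_on X D \<longleftrightarrow> D \<subseteq> Pow X \<and> X \<in> D \<and> {} \<notin> D \<and>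
     (\<forall>A\<in>D. \<forall>B\<in>D. A \<inter> B \<in> D) \<and>
     (\<forall>A\<in>D. \<forall>B. A \<subseteq> B \<and> B \<subseteq> X \<longrightarrow> B \<in> D) \<and>
     (\<forall>A. A \<subseteq> X \<longrightarrow> A \<in> D \<or> X - A \<in> D)"

definition uniform_ultrafilter :: "'a set set \<Rightarrow> bool" where
  "uniform_ultrafilter D \<longleftrightarrow>
     ultrafilter_on UNIV D \<and> (\<forall>A\<in>D. |A| =o |UNIV :: 'a set| )"

definition nondecreasing_unbounded :: "('a::wellorder \<Rightarrow> 'a) set" where
  "nondecreasing_unbounded = {f. mono f \<and> (\<forall>\<alpha>. \<exists>\<beta>. \<alpha> < f \<beta>)}"

definition weakly_reasonable_ultrafilter :: "('a::wellorder) set set \<Rightarrow> bool" where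
  "weakly_reasonable_ultrafilter D \<longleftrightarrow> uniform_ultrafilter D \<and>
     (\<forall>f\<in>nondecreasing_unbounded. \<exists>C. club C \<and> (\<Union>\<delta>\<in>C. {\<delta>..<oadd \<delta> (f \<delta>)}) \<notin> D)"


section \<open>The conditions and their filters\<close>

record 'a cond =
  Cl :: "'a set"
  Zl :: "'a \<Rightarrow> 'a set"
  dl :: "'a \<Rightarrow> 'a set set"

(* Sequences indexed by \<open>Cl p\<close> are total functions fixed to be undefined outside \<open>Cl p\<close>. *)
definition Q0 :: "('a::wellorder) cond set" where
  "Q0 = {p. club (Cl p) \<and> (\<forall>\<delta>\<in>Cl p. is_limit \<delta>) \<and>
     Zl p \<in> extensional (Cl p) \<and> dl p \<in> extensional (Cl p) \<and>
     (\<forall>\<delta>\<in>Cl p. Zl p \<delta> = {\<delta>..<(LEAST \<beta>. \<beta> \<in> Cl p - {..\<delta>})} \<and>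
                ultrafilter_on (Zl p \<delta>) (dl p \<delta>))}"

definition fil :: "('a::wellorder) cond \<Rightarrow> 'a set set" where
  "fil q = {A. \<exists>\<epsilon>. \<forall>\<delta>\<in>Cl q - {..<\<epsilon>}. A \<inter> Zl q \<delta> \<in> dl q \<delta>}"

definition Fil :: "('a::wellorder) cond set \<Rightarrow> 'a set set" where
  "Fil G = (\<Union>p\<in>G. fil p)"

definition le0 :: "('a::wellorder) cond \<Rightarrow> 'a cond \<Rightarrow> bool" (infix "\<le>\<^sup>0" 50) where
  "p \<le>\<^sup>0 q \<longleftrightarrow> fil p \<subseteq> fil q"

definition directed :: "('a::wellorder) cond set \<Rightarrow> bool" where
  "directed G \<longleftrightarrow> (\<forall>A. A \<subseteq> G \<and> finite A \<longrightarrow> (\<exists>q\<in>G. \<forall>p\<in>A. p \<le>\<^sup>0 q))"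

definition countably_directed :: "('a::wellorder) cond set \<Rightarrow> bool" where
  "countably_directed G \<longleftrightarrow> (\<forall>A. A \<subseteq> G \<and> countable A \<longrightarrow> (\<exists>q\<in>G. \<forall>p\<in>A. p \<le>\<^sup>0 q))"

definition cond_fun :: "('a::wellorder) cond \<Rightarrow> 'a \<Rightarrow> 'a" where
  "cond_fun p \<alpha> = (THE \<gamma>. \<gamma> \<in> Cl p \<and>
     has_order_type (Cl p \<inter> {..<\<gamma>}) (oadd (omult omega \<alpha>) omega))"


section \<open>Dominating families\<close>

definition dominating :: "('a::wellorder \<Rightarrow> 'a) set \<Rightarrow> bool" where
  "dominating F \<longleftrightarrow> (\<forall>g. \<exists>f\<in>F. \<exists>\<alpha>. \<forall>\<beta>>\<alpha>. g \<beta> < f \<beta>)"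

definition club_dominating :: "('a::wellorder \<Rightarrow> 'a) set \<Rightarrow> bool" where
  "club_dominating F \<longleftrightarrow> (\<forall>g. \<exists>f\<in>F. \<not> stationary {\<beta>. g \<beta> \<ge> f \<beta>})"

end

theory Submission
  imports Defs
begin

(* If the union A of the intervals [\<delta>, \<delta> + f(\<delta>)), \<delta> \<in> C, is not in the ultrafilter, then the complement
   of A lies in fil(p) for some p, so no late block of p is contained in a single such interval.
   As f_p(\<alpha>) has more than \<alpha> predecessors in C^p, some x \<in> C^p satisfies \<alpha> \<le> x < f_p(\<alpha>); the block
   of p starting at x ends at or before f_p(\<alpha>), and therefore f(c) < f_p(\<alpha>) whenever
   c \<in> C, c \<le> \<alpha> and \<alpha> is large.

   Part (2) follows with \<alpha> = c. For (1), choose decreasing clubs C_n and functions f_n in such a way that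
   f_{n+1}(\<delta>) bounds g below the successor of \<delta> in C_n, and let q bound the corresponding
   conditions p_n. For large \<alpha> the ordinals max (C_n \<inter> (\<alpha> + 1)) do not increase with n, so two
   consecutive ones coincide; if c is their common value, then g(\<alpha>) \<le> f_{n+1}(c) < f_q(\<alpha>). *)

section \<open>Order types of sets of ordinals\<close>

lemma le_rel_iff: "(a, b) \<in> le_rel A \<longleftrightarrow> a \<in> A \<and> b \<in> A \<and> a \<le> b"
  by (auto simp: le_rel_def relation_of_def)

lemma Field_le_rel [simp]: "Field (le_rel A) = A"
  by (auto simp: Field_def Domain_iff Range_iff le_rel_iff)

lemma well_order_le_rel: "well_order_on A (le_rel A)"
proof -
  have "wf (le_rel A - Id)"
    by (rule wf_subset[OF wf]) (auto simp: le_rel_iff)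
  then show ?thesis
    unfolding well_order_on_def linear_order_on_def partial_order_on_def preorder_on_def
    by (auto simp: refl_on_def trans_def antisym_def total_on_def le_rel_iff)
qed

lemma Well_order_le_rel: "Well_order (le_rel A)"
  using well_order_le_rel[of A] by simp

lemma Restr_underS_le_rel:
  "a \<in> A \<Longrightarrow> Restr (le_rel A) (underS (le_rel A) a) = le_rel (A \<inter> {..<a})"
  by (auto simp: underS_def le_rel_iff)

lemma le_rel_initial_segment_ordLess: "a \<in> A \<Longrightarrow> le_rel (A \<inter> {..<a}) <o le_rel A"
  using underS_Restr_ordLess[OF Well_order_le_rel, of A a] by (auto simp: Restr_underS_le_rel)

lemma has_order_type_obtain:
  assumes "has_order_type A \<tau>"
  obtains h where "\<And>\<xi>. \<xi> < \<tau> \<Longrightarrow> h \<xi> \<in> A" "\<And>\<xi> \<eta>. \<xi> < \<eta> \<Longrightarrow> \<eta> < \<tau> \<Longrightarrow> h \<xi> < h \<eta>"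
proof -
  have "le_rel {..<\<tau>} =o le_rel A"
    using assms ordIso_symmetric by (auto simp: has_order_type_def)
  then obtain h where "iso (le_rel {..<\<tau>}) (le_rel A) h"
    by (auto simp: ordIso_def)
  then have bij: "bij_betw h {..<\<tau>} A"
    and mono: "\<forall>\<xi>\<in>{..<\<tau>}. \<forall>\<eta>\<in>{..<\<tau>}. (\<xi>, \<eta>) \<in> le_rel {..<\<tau>} \<longleftrightarrow> (h \<xi>, h \<eta>) \<in> le_rel A"
    by (auto simp: iso_iff2)
  show ?thesis
  proof
    show "h \<xi> \<in> A" if "\<xi> < \<tau>" for \<xi>
      using bij that by (auto simp: bij_betw_def)
    show "h \<xi> < h \<eta>" if "\<xi> < \<eta>" "\<eta> < \<tau>" for \<xi> \<eta>
      using mono that by (metis le_rel_iff lessThan_iff less_trans not_le order.strict_iff_order)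
  qed
qed

text \<open>At a least \<alpha> with \<open>h \<alpha> < \<alpha>\<close>, applying \<open>h\<close>
  once more gives \<open>h (h \<alpha>) < h \<alpha>\<close>, a smaller counterexample.\<close>

lemma strictly_increasing_ge:
  fixes h :: "'a::wellorder \<Rightarrow> 'a"
  assumes "\<And>\<xi> \<eta>. \<xi> < \<eta> \<Longrightarrow> \<eta> < \<tau> \<Longrightarrow> h \<xi> < h \<eta>" "\<alpha> < \<tau>"
  shows "\<alpha> \<le> h \<alpha>"
  using assms(2)
proof (induction \<alpha> rule: less_induct)
  case (less \<alpha>)
  show ?case
  proof (rule ccontr)
    assume "\<not> \<alpha> \<le> h \<alpha>"
    then have "h \<alpha> < \<alpha>" by simp
    then have "h (h \<alpha>) < h \<alpha>" and "h \<alpha> \<le> h (h \<alpha>)"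
      using assms(1) less by auto
    then show False by simp
  qed
qed

lemma has_order_type_exceeds:
  assumes "has_order_type A \<tau>" "\<alpha> < \<tau>"
  shows "\<exists>x\<in>A. \<alpha> \<le> x"
proof -
  obtain h where "\<And>\<xi>. \<xi> < \<tau> \<Longrightarrow> h \<xi> \<in> A" "\<And>\<xi> \<eta>. \<xi> < \<eta> \<Longrightarrow> \<eta> < \<tau> \<Longrightarrow> h \<xi> < h \<eta>"
    using has_order_type_obtain[OF assms(1)] by blast
  then show ?thesis
    using strictly_increasing_ge assms(2) by blast
qed

text \<open>No well-order is isomorphic to a proper initial segment of itself. This makes the
  description in \<open>cond_fun\<close> unambiguous.\<close>

lemma has_order_type_segment_unique:
  assumes "\<gamma> \<in> C" "has_order_type (C \<inter> {..<\<gamma>}) \<tau>"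
    and "\<gamma>' \<in> C" "has_order_type (C \<inter> {..<\<gamma>'}) \<tau>"
  shows "\<gamma> = \<gamma>'"
proof -
  have *: False
    if "a < b" "a \<in> C" "has_order_type (C \<inter> {..<a}) \<tau>" "has_order_type (C \<inter> {..<b}) \<tau>" for a b
  proof -
    have "le_rel ((C \<inter> {..<b}) \<inter> {..<a}) <o le_rel (C \<inter> {..<b})"
      using that by (intro le_rel_initial_segment_ordLess) auto
    moreover have "(C \<inter> {..<b}) \<inter> {..<a} = C \<inter> {..<a}"
      using \<open>a < b\<close> by auto
    moreover have "le_rel (C \<inter> {..<a}) =o le_rel (C \<inter> {..<b})"
      using that(3,4) ordIso_transitive ordIso_symmetric unfolding has_order_type_def by blast
    ultimately show False
      using not_ordLess_ordIso by metis
  qed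
  show ?thesis
    using * assms by (metis linorder_neqE)
qed

section \<open>Clubs and descending sequences\<close>

lemma club_has_greatest_below:
  assumes "club C" "m \<in> C" "m \<le> \<alpha>"
  shows "\<exists>c\<in>C. c \<le> \<alpha> \<and> (\<forall>x\<in>C. x \<le> \<alpha> \<longrightarrow> x \<le> c)"
proof -
  define s where "s = (LEAST s. \<forall>x\<in>C. x \<le> \<alpha> \<longrightarrow> x \<le> s)"
  have s: "\<forall>x\<in>C. x \<le> \<alpha> \<longrightarrow> x \<le> s"
    unfolding s_def by (rule LeastI[of _ \<alpha>]) auto
  have "s \<le> \<alpha>"
    unfolding s_def by (rule Least_le) auto
  have approx: "\<exists>x\<in>C. b < x \<and> x \<le> \<alpha>" if "b < s" for b
    using not_less_Least[OF that[unfolded s_def]] by (auto simp: not_le)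
  \<comment> \<open>A supremum that is not attained is a limit of points of \<open>C\<close>, so
    closure puts it into \<open>C\<close> after all.\<close>
  have "s \<in> C"
  proof (rule ccontr)
    assume "s \<notin> C"
    then have approx': "\<exists>x\<in>C. b < x \<and> x < s" if "b < s" for b
      using approx[OF that] s by (metis order.order_iff_strict)
    \<comment> \<open>Limit ordinals are nonzero by definition; \<open>m\<close> witnesses an
      ordinal below \<open>s\<close>.\<close>
    moreover have "m < s"
      using s assms \<open>s \<notin> C\<close> by (metis order.order_iff_strict)
    ultimately have "is_limit s"
      unfolding is_limit_def by blast
    then have "s \<in> C"
      using approx' assms(1) unfolding club_def by blast
    then show False
      using \<open>s \<notin> C\<close> by simp
  qed
  then show ?thesis
    using s \<open>s \<le> \<alpha>\<close> by blast
qed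

lemma decreasing_stabilizes:
  fixes c :: "nat \<Rightarrow> 'a::wellorder"
  assumes "\<And>n. c (Suc n) \<le> c n"
  shows "\<exists>n. c (Suc n) = c n"
proof -
  define m where "m = (LEAST x. x \<in> range c)"
  have "m \<in> range c"
    unfolding m_def by (rule LeastI[of _ "c 0"]) simp
  then obtain n where n: "m = c n" by blast
  have "m \<le> c (Suc n)"
    unfolding m_def by (rule Least_le) simp
  then show ?thesis
    using n assms[of n] by (metis antisym)
qed

section \<open>Boundedness from the regularity of \<lambda>\<close>

context
  assumes reg: "regular_uncountable_cardinal (le_rel (UNIV :: 'a::wellorder set))"
begin

lemma infinite_regular: "infinite (UNIV :: 'a set)"
proof
  assume fin: "finite (UNIV :: 'a set)"
  have "natLeq <o |UNIV :: 'a set|"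
    using reg card_of_Field_ordIso[of "le_rel (UNIV :: 'a set)"]
    by (auto simp: regular_uncountable_cardinal_def intro: ordLess_ordIso_trans ordIso_symmetric)
  then show False
    using fin infinite_iff_natLeq_ordLeq ordLess_imp_ordLeq by blast
qed

lemma exists_greater: "\<exists>b::'a. a < b"
  using infinite_Card_order_limit[of "le_rel (UNIV :: 'a set)" a] reg infinite_regular
  by (auto simp: regular_uncountable_cardinal_def le_rel_iff order.strict_iff_order)

text \<open>Regularity gives every cofinal set full cardinality. Since \<open>cofinal\<close> asks
  for strictly larger elements, the weak inequality is applied to some \<open>y\<close> above
  \<open>x\<close>.\<close>

lemma unbounded_ordIso:
  fixes A :: "'a set"
  assumes "\<forall>b. \<exists>a\<in>A. b \<le> a"
  shows "|A| =o le_rel (UNIV :: 'a set)"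
proof -
  have "cofinal A (le_rel (UNIV :: 'a set))"
    unfolding cofinal_def
  proof
    fix x :: 'a
    obtain y where "x < y"
      using exists_greater by blast
    then show "\<exists>b\<in>A. x \<noteq> b \<and> (x, b) \<in> le_rel UNIV"
      using assms by (metis UNIV_I le_rel_iff leD less_imp_le order.trans)
  qed
  then show ?thesis
    using reg by (auto simp: regular_uncountable_cardinal_def regularCard_def)
qed

lemma small_bounded:
  fixes A :: "'a set"
  assumes "|A| <o le_rel (UNIV :: 'a set)"
  shows "\<exists>b. \<forall>a\<in>A. a < b"
  using unbounded_ordIso[of A] assms not_ordLess_ordIso by (metis not_le)

lemma card_lessThan: "|{..<a :: 'a}| <o le_rel (UNIV :: 'a set)"
proof -
  have "underS (le_rel UNIV) a = {..<a}"
    by (auto simp: underS_def le_rel_iff)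
  then show ?thesis
    using card_of_underS[of "le_rel (UNIV :: 'a set)" a] reg
    by (auto simp: regular_uncountable_cardinal_def)
qed

lemma image_lessThan_bounded: "\<exists>b::'a. \<forall>x<a. f x < b" for a :: 'a
  using small_bounded[OF ordLeq_ordLess_trans[OF card_of_image[of f "{..<a}"] card_lessThan]] by auto

text \<open>Uncountability of \<lambda> makes the range of a sequence smaller than
  \<lambda>.\<close>

lemma sequence_bounded: "\<exists>b::'a. \<forall>n. f n < b" for f :: "nat \<Rightarrow> 'a"
proof -
  have "|range f| \<le>o natLeq"
    using card_of_image card_of_nat ordLeq_ordIso_trans by blast
  then have "|range f| <o le_rel (UNIV :: 'a set)"
    using reg ordLeq_ordLess_trans by (auto simp: regular_uncountable_cardinal_def)
  then show ?thesis
    using small_bounded by blast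
qed

section \<open>Ordinal sum and product\<close>

lemma oadd_bounds: "\<alpha> \<le> oadd \<alpha> \<beta> \<and> (\<forall>\<beta>'<\<beta>. oadd \<alpha> \<beta>' < oadd \<alpha> \<beta>)" for \<alpha> \<beta> :: 'a
proof -
  obtain b where "\<forall>\<beta>'<\<beta>. oadd \<alpha> \<beta>' < b"
    using image_lessThan_bounded[of \<beta> "oadd \<alpha>"] by blast
  \<comment> \<open>\<open>oadd\<close> is a LEAST, so its defining inequalities can be read off
    only once some candidate is exhibited.\<close>
  then have "\<alpha> \<le> max b \<alpha> \<and> (\<forall>\<beta>'\<in>{..<\<beta>}. oadd \<alpha> \<beta>' < max b \<alpha>)"
    by (auto simp: less_max_iff_disj)
  then have "\<alpha> \<le> oadd \<alpha> \<beta> \<and> (\<forall>\<beta>'\<in>{..<\<beta>}. oadd \<alpha> \<beta>' < oadd \<alpha> \<beta>)"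
    unfolding oadd.simps[of \<alpha> \<beta>] by (rule LeastI)
  then show ?thesis
    by simp
qed

lemma oadd_ge_left: "\<alpha> \<le> oadd \<alpha> \<beta>" for \<alpha> \<beta> :: 'a
  using oadd_bounds by blast

lemma oadd_ge_right: "\<beta> \<le> oadd \<alpha> \<beta>" for \<alpha> \<beta> :: 'a
proof (induction \<beta> rule: less_induct)
  case (less \<beta>)
  then show ?case
    using oadd_bounds by (metis leD leI le_less_trans)
qed

lemma oadd_greater_left: "\<alpha> < oadd \<alpha> \<beta>" if "\<beta>' < \<beta>" for \<alpha> \<beta> :: 'a
  using oadd_bounds oadd_ge_left that by (metis le_less_trans)

lemma omult_upper: "oadd (omult \<alpha> \<beta>') \<alpha> \<le> omult \<alpha> \<beta>" if "\<beta>' < \<beta>" for \<alpha> \<beta> :: 'a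
proof -
  obtain b where "\<forall>\<beta>'<\<beta>. oadd (omult \<alpha> \<beta>') \<alpha> < b"
    using image_lessThan_bounded[of \<beta> "\<lambda>\<beta>'. oadd (omult \<alpha> \<beta>') \<alpha>"] by blast
  then have "\<forall>\<beta>'\<in>{..<\<beta>}. oadd (omult \<alpha> \<beta>') \<alpha> \<le> b"
    by auto
  then have "\<forall>\<beta>'\<in>{..<\<beta>}. oadd (omult \<alpha> \<beta>') \<alpha> \<le> omult \<alpha> \<beta>"
    unfolding omult.simps[of \<alpha> \<beta>] by (rule LeastI)
  then show ?thesis
    using that by simp
qed

text \<open>For nonzero \<alpha> and \<beta>' < \<beta>, induction gives \<beta>' \<le> \<alpha>
  \<cdot> \<beta>' < \<alpha> \<cdot> \<beta>' + \<alpha> \<le> \<alpha> \<cdot> \<beta>.\<close>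

lemma omult_ge_right: "\<beta> \<le> omult \<alpha> \<beta>" if "\<xi> < \<alpha>" for \<alpha> \<beta> :: 'a
proof (induction \<beta> rule: less_induct)
  case (less \<beta>)
  have "\<beta>' < omult \<alpha> \<beta>" if "\<beta>' < \<beta>" for \<beta>'
    using less[OF that] oadd_greater_left[OF \<open>\<xi> < \<alpha>\<close>] omult_upper[OF that]
    by (meson le_less_trans less_le_trans)
  then show ?case
    by (meson leI less_irrefl)
qed

text \<open>The assumption guarantees that some limit ordinal exists, so that the LEAST in
  \<open>omega\<close> denotes one; being a limit, it is nonzero.\<close>

lemma less_omega_mult_add_omega:
  assumes "is_limit (\<delta> :: 'a)"
  shows "\<alpha> < oadd (omult omega \<alpha>) (omega :: 'a)"
proof -
  have "is_limit (omega :: 'a)"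
    unfolding omega_def using assms by (rule LeastI)
  then obtain \<xi> :: 'a where "\<xi> < omega"
    by (auto simp: is_limit_def)
  then show ?thesis
    using omult_ge_right oadd_greater_left by (meson le_less_trans)
qed

section \<open>The functions f_p\<close>

lemma club_enumeration:
  fixes C :: "'a set"
  assumes "club C"
  shows "\<exists>\<gamma>\<in>C. has_order_type (C \<inter> {..<\<gamma>}) \<tau>"
proof -
  \<comment> \<open>An unbounded set has \<lambda> elements, so its order type is at least \<lambda>
    and exceeds \<tau>; thus \<tau> is the type of a proper initial segment of
    \<open>C\<close>.\<close>
  have "le_rel {..<\<tau>} <o le_rel (UNIV :: 'a set)"
    using le_rel_initial_segment_ordLess[of \<tau> UNIV] by simp
  also have "le_rel (UNIV :: 'a set) =o |C|"
    using unbounded_ordIso[of C] assms ordIso_symmetric by (meson club_def less_imp_le)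
  also have "|C| \<le>o le_rel C"
    by (rule card_of_least[OF well_order_le_rel])
  finally obtain \<gamma> where \<gamma>: "\<gamma> \<in> C" "le_rel {..<\<tau>} =o Restr (le_rel C) (underS (le_rel C) \<gamma>)"
    using ordLess_iff_ordIso_Restr[OF Well_order_le_rel Well_order_le_rel] by auto
  then show ?thesis
    using ordIso_symmetric Restr_underS_le_rel[OF \<gamma>(1)] by (auto simp: has_order_type_def)
qed

lemma cond_fun_properties:
  fixes p :: "'a cond"
  assumes "club (Cl p)"
  shows "cond_fun p \<alpha> \<in> Cl p"
    and "has_order_type (Cl p \<inter> {..<cond_fun p \<alpha>}) (oadd (omult omega \<alpha>) omega)"
proof -
  have "\<exists>!\<gamma>. \<gamma> \<in> Cl p \<and> has_order_type (Cl p \<inter> {..<\<gamma>}) (oadd (omult omega \<alpha>) omega)"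
    using club_enumeration[OF assms] has_order_type_segment_unique[of _ "Cl p"] by blast
  from theI'[OF this]
  show "cond_fun p \<alpha> \<in> Cl p"
    and "has_order_type (Cl p \<inter> {..<cond_fun p \<alpha>}) (oadd (omult omega \<alpha>) omega)"
    unfolding cond_fun_def by auto
qed

lemma block_start_below_cond_fun:
  fixes p :: "'a cond"
  assumes "p \<in> Q0"
  shows "\<exists>x\<in>Cl p. \<alpha> \<le> x \<and> x < cond_fun p \<alpha>"
proof -
  have club: "club (Cl p)" and lim: "\<forall>\<delta>\<in>Cl p. is_limit \<delta>"
    using assms by (auto simp: Q0_def)
  then obtain \<delta> where "is_limit (\<delta> :: 'a)"
    using cond_fun_properties(1) by blast
  then show ?thesis
    using has_order_type_exceeds[OF cond_fun_properties(2)[OF club] less_omega_mult_add_omega] by auto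
qed

text \<open>Otherwise a block of \<open>p\<close> starting at or after \<epsilon> would lie inside
  [c, c + f(c)), and its ultrafilter would contain the empty set.\<close>

lemma less_cond_fun:
  fixes p :: "'a cond"
  assumes p: "p \<in> Q0"
    and late: "\<forall>\<delta>\<in>Cl p - {..<\<epsilon>}. (UNIV - (\<Union>\<delta>\<in>C. {\<delta>..<oadd \<delta> (f \<delta>)})) \<inter> Zl p \<delta> \<in> dl p \<delta>"
    and "c \<in> C" "c \<le> \<alpha>" "\<epsilon> \<le> \<alpha>"
  shows "f c < cond_fun p \<alpha>"
proof (rule ccontr)
  assume "\<not> f c < cond_fun p \<alpha>"
  then have le: "cond_fun p \<alpha> \<le> oadd c (f c)"
    using oadd_ge_right by (metis le_less_trans linorder_not_le)
  obtain x where x: "x \<in> Cl p" "\<alpha> \<le> x" "x < cond_fun p \<alpha>"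
    using block_start_below_cond_fun[OF p] by blast
  have "cond_fun p \<alpha> \<in> Cl p"
    using cond_fun_properties(1) p by (auto simp: Q0_def)
  \<comment> \<open>\<open>cond_fun p \<alpha>\<close> is a point of \<open>Cl p\<close> above
    \<open>x\<close>, so the successor of \<open>x\<close> in \<open>Cl p\<close>, where the block
    ends, does not pass it.\<close>
  then have "(LEAST \<beta>. \<beta> \<in> Cl p - {..x}) \<le> cond_fun p \<alpha>"
    using x by (intro Least_le) auto
  moreover have Z: "Zl p x = {x..<(LEAST \<beta>. \<beta> \<in> Cl p - {..x})}"
    and uf: "ultrafilter_on (Zl p x) (dl p x)"
    using p x(1) unfolding Q0_def by blast+
  ultimately have "Zl p x \<subseteq> {c..<oadd c (f c)}"
    unfolding Z using le x(2) \<open>c \<le> \<alpha>\<close> by auto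
  then have "(UNIV - (\<Union>\<delta>\<in>C. {\<delta>..<oadd \<delta> (f \<delta>)})) \<inter> Zl p x = {}"
    using \<open>c \<in> C\<close> by blast
  moreover have "(UNIV - (\<Union>\<delta>\<in>C. {\<delta>..<oadd \<delta> (f \<delta>)})) \<inter> Zl p x \<in> dl p x"
    using late x \<open>\<epsilon> \<le> \<alpha>\<close> by auto
  ultimately show False
    using uf by (auto simp: ultrafilter_on_def)
qed

section \<open>Restriction and intersection of clubs\<close>

lemma club_from:
  fixes C :: "'a set"
  assumes "club C"
  shows "club (C \<inter> {\<epsilon>..})"
  unfolding club_def
proof (intro conjI allI impI)
  show "\<exists>\<beta>\<in>C \<inter> {\<epsilon>..}. \<alpha> < \<beta>" for \<alpha>
    using assms unfolding club_def
    by (metis IntI atLeast_iff less_imp_le max.strict_boundedE)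
  fix \<delta>
  assume \<delta>: "is_limit \<delta> \<and> (\<forall>\<alpha><\<delta>. \<exists>\<beta>\<in>C \<inter> {\<epsilon>..}. \<alpha> < \<beta> \<and> \<beta> < \<delta>)"
  then have "\<delta> \<in> C"
    using assms unfolding club_def by blast
  moreover have "\<epsilon> \<le> \<delta>"
    using \<delta> unfolding is_limit_def by (meson IntD2 atLeast_iff less_imp_le order.trans)
  ultimately show "\<delta> \<in> C \<inter> {\<epsilon>..}" by simp
qed

text \<open>Unboundedness comes from picking points of \<open>C\<close> and \<open>D\<close>
  alternately; the supremum of such an \<omega>-sequence stays below \<lambda> and is a limit of
  both clubs.\<close>

lemma club_Int:
  fixes C D :: "'a set"
  assumes "club C" "club D"
  shows "club (C \<inter> D)"
  unfolding club_def
proof (intro conjI allI impI)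
  fix \<alpha> :: 'a
  obtain u where u: "\<And>x. u x \<in> C \<and> x < u x"
    using assms(1) unfolding club_def by metis
  obtain v where v: "\<And>x. v x \<in> D \<and> x < v x"
    using assms(2) unfolding club_def by metis
  define x where "x = rec_nat \<alpha> (\<lambda>_ y. v (u y))"
  have x_simps: "x 0 = \<alpha>" "\<And>n. x (Suc n) = v (u (x n))"
    by (auto simp: x_def)
  have step: "x n < u (x n)" "u (x n) < x (Suc n)" "u (x n) \<in> C" "x (Suc n) \<in> D" for n
    using u v by (auto simp: x_simps)
  define s where "s = (LEAST s. \<forall>n. x n < s)"
  obtain b where b: "\<forall>n. x n < b"
    using sequence_bounded[of x] by blast
  have above: "x n < s" for n
    using LeastI[of "\<lambda>s. \<forall>n. x n < s", OF b] by (simp add: s_def)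
  \<comment> \<open>The sequence is strictly increasing, so a term that merely reaches \<xi> is
    followed by one above it.\<close>
  have approx: "\<exists>n. \<xi> < x n" if less: "\<xi> < s" for \<xi>
  proof -
    obtain n where "\<xi> \<le> x n"
      using not_less_Least[OF less[unfolded s_def]] by (auto simp: not_less)
    then show ?thesis
      using step by (meson le_less_trans less_trans)
  qed
  have "is_limit s"
    unfolding is_limit_def using above approx by blast
  moreover have "\<exists>\<beta>\<in>C. \<xi> < \<beta> \<and> \<beta> < s" "\<exists>\<beta>\<in>D. \<xi> < \<beta> \<and> \<beta> < s" if "\<xi> < s" for \<xi>
    using approx[OF that] step above by (meson less_trans)+
  ultimately have "s \<in> C \<inter> D"
    using assms unfolding club_def by blast
  then show "\<exists>\<beta>\<in>C \<inter> D. \<alpha> < \<beta>"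
    using above[of 0] by (auto simp: x_simps)
next
  fix \<delta>
  assume "is_limit \<delta> \<and> (\<forall>\<alpha><\<delta>. \<exists>\<beta>\<in>C \<inter> D. \<alpha> < \<beta> \<and> \<beta> < \<delta>)"
  then show "\<delta> \<in> C \<inter> D"
    using assms unfolding club_def by blast
qed

section \<open>Majorants and weak reasonability\<close>

lemma nondecreasing_majorant:
  fixes g :: "'a \<Rightarrow> 'a"
  shows "\<exists>f\<in>nondecreasing_unbounded. \<forall>\<alpha> \<beta>. \<alpha> \<le> \<beta> \<longrightarrow> g \<alpha> \<le> f \<beta>"
proof -
  \<comment> \<open>The least such \<gamma> is the value at \<beta>:
    \<open>\<beta> \<le> \<gamma>\<close> yields unboundedness, and ranging over all \<alpha> \<le>
    \<beta> helps to make the value monotone.\<close>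
  define P where "P \<beta> \<gamma> \<longleftrightarrow> \<beta> \<le> \<gamma> \<and> (\<forall>\<alpha>\<le>\<beta>. g \<alpha> \<le> \<gamma>)" for \<beta> \<gamma>
  have "\<exists>\<gamma>. P \<beta> \<gamma>" for \<beta>
  proof -
    obtain \<beta>' where "\<beta> < \<beta>'"
      using exists_greater by blast
    moreover obtain b where "\<forall>\<alpha><\<beta>'. g \<alpha> < b"
      using image_lessThan_bounded[of \<beta>' g] by blast
    ultimately have "P \<beta> (max \<beta> b)"
      unfolding P_def by (simp add: le_less_trans less_imp_le le_max_iff_disj)
    then show ?thesis ..
  qed
  then have P: "P \<beta> (LEAST \<gamma>. P \<beta> \<gamma>)" for \<beta>
    by (meson LeastI)
  have "mono (\<lambda>\<beta>. LEAST \<gamma>. P \<beta> \<gamma>)"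
  proof (rule monoI)
    fix \<beta> \<beta>' :: 'a
    assume "\<beta> \<le> \<beta>'"
    then have "P \<beta> (LEAST \<gamma>. P \<beta>' \<gamma>)"
      using P[of \<beta>'] unfolding P_def by (meson order.trans)
    then show "(LEAST \<gamma>. P \<beta> \<gamma>) \<le> (LEAST \<gamma>. P \<beta>' \<gamma>)"
      by (rule Least_le)
  qed
  moreover have "\<forall>\<alpha>. \<exists>\<beta>. \<alpha> < (LEAST \<gamma>. P \<beta> \<gamma>)"
    using P exists_greater unfolding P_def by (meson less_le_trans)
  ultimately have "(\<lambda>\<beta>. LEAST \<gamma>. P \<beta> \<gamma>) \<in> nondecreasing_unbounded"
    by (simp add: nondecreasing_unbounded_def)
  moreover have "\<forall>\<alpha> \<beta>. \<alpha> \<le> \<beta> \<longrightarrow> g \<alpha> \<le> (LEAST \<gamma>. P \<beta> \<gamma>)"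
    using P unfolding P_def by blast
  ultimately show ?thesis
    by (intro bexI[of _ "\<lambda>\<beta>. LEAST \<gamma>. P \<beta> \<gamma>"])
qed

text \<open>An ultrafilter contains the complement of a set that it omits, and membership in the
  union \<open>Fil G\<close> is witnessed by a single condition.\<close>

lemma weakly_reasonable_complement:
  fixes G :: "'a cond set"
  assumes "weakly_reasonable_ultrafilter (Fil G)" "f \<in> nondecreasing_unbounded"
  shows "\<exists>C. club C \<and> (\<exists>p\<in>G. UNIV - (\<Union>\<delta>\<in>C. {\<delta>..<oadd \<delta> (f \<delta>)}) \<in> fil p)"
proof -
  obtain C where C: "club C" "(\<Union>\<delta>\<in>C. {\<delta>..<oadd \<delta> (f \<delta>)}) \<notin> Fil G"
    using assms unfolding weakly_reasonable_ultrafilter_def by blast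
  have "\<forall>A. A \<in> Fil G \<or> UNIV - A \<in> Fil G"
    using assms(1)
    by (simp add: weakly_reasonable_ultrafilter_def uniform_ultrafilter_def ultrafilter_on_def)
  with C(2) have "UNIV - (\<Union>\<delta>\<in>C. {\<delta>..<oadd \<delta> (f \<delta>)}) \<in> Fil G"
    by blast
  then show ?thesis
    using C(1) by (auto simp: Fil_def)
qed

section \<open>Domination by the functions f_p\<close>

lemma club_dominating_cond_fun:
  fixes G :: "'a cond set"
  assumes "G \<subseteq> Q0" "weakly_reasonable_ultrafilter (Fil G)"
  shows "club_dominating {cond_fun p | p. p \<in> G}"
  unfolding club_dominating_def
proof
  fix g :: "'a \<Rightarrow> 'a"
  obtain f where f: "f \<in> nondecreasing_unbounded" "\<forall>\<alpha> \<beta>. \<alpha> \<le> \<beta> \<longrightarrow> g \<alpha> \<le> f \<beta>"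
    using nondecreasing_majorant[of g] by blast
  obtain C p where C: "club C" and p: "p \<in> G" "UNIV - (\<Union>\<delta>\<in>C. {\<delta>..<oadd \<delta> (f \<delta>)}) \<in> fil p"
    using weakly_reasonable_complement[OF assms(2) f(1)] by blast
  then obtain \<epsilon> where
    \<epsilon>: "\<forall>\<delta>\<in>Cl p - {..<\<epsilon>}. (UNIV - (\<Union>\<delta>\<in>C. {\<delta>..<oadd \<delta> (f \<delta>)})) \<inter> Zl p \<delta> \<in> dl p \<delta>"
    unfolding fil_def by blast
  \<comment> \<open>With \<open>c = \<alpha>\<close> a point of \<open>C\<close>, g(\<alpha>) \<le>
    f(\<alpha>) < f_p(\<alpha>); the points of \<open>C\<close> from \<epsilon> on still form a
    club.\<close>
  have "g \<alpha> < cond_fun p \<alpha>" if "\<alpha> \<in> C \<inter> {\<epsilon>..}" for \<alpha>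
    using less_cond_fun[OF _ \<epsilon>, of \<alpha> \<alpha>] that assms(1) p(1) f(2) by (auto intro: le_less_trans)
  then have "{\<beta>. cond_fun p \<beta> \<le> g \<beta>} \<inter> (C \<inter> {\<epsilon>..}) = {}"
    by (fastforce simp: not_le[symmetric])
  then have "\<not> stationary {\<beta>. cond_fun p \<beta> \<le> g \<beta>}"
    using club_from[OF C] unfolding stationary_def by blast
  then show "\<exists>f\<in>{cond_fun p |p. p \<in> G}. \<not> stationary {\<beta>. f \<beta> \<le> g \<beta>}"
    using p(1) by blast
qed

lemma dominating_cond_fun:
  fixes G :: "'a cond set"
  assumes "G \<subseteq> Q0" "countably_directed G" "weakly_reasonable_ultrafilter (Fil G)"
  shows "dominating {cond_fun p | p. p \<in> G}"
  unfolding dominating_def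
proof
  fix g :: "'a \<Rightarrow> 'a"
  define A where "A C f = (\<Union>\<delta>\<in>C. {\<delta>..<oadd \<delta> (f \<delta>)})" for C and f :: "'a \<Rightarrow> 'a"
  (* B is the club given by weak reasonability, C its intersection with the earlier clubs. *)
  define good where "good C f \<longleftrightarrow> club C \<and> (\<exists>B p. C \<subseteq> B \<and> p \<in> G \<and> UNIV - A B f \<in> fil p)" for C f
  \<comment> \<open>f(c) is to bound \<open>g\<close> through the gap of \<open>C\<close> after
    \<open>c\<close>: any \<alpha> whose last point of \<open>C\<close> at or below it is
    \<open>c\<close> lies below \<open>n\<close>.\<close>
  define bounds where
    "bounds C f \<longleftrightarrow> (\<forall>c. \<exists>n\<in>C. c < n \<and> (\<forall>\<alpha>\<le>n. g \<alpha> \<le> f c))" for C f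
  have majorant: "\<exists>f. f \<in> nondecreasing_unbounded \<and> bounds C f" if club: "club C" for C
  proof -
    obtain nx where nx: "\<And>c. nx c \<in> C \<and> c < nx c"
      using club unfolding club_def by metis
    obtain h where h: "\<forall>\<alpha> \<beta>. \<alpha> \<le> \<beta> \<longrightarrow> g \<alpha> \<le> h \<beta>"
      using nondecreasing_majorant[of g] by blast
    \<comment> \<open>\<open>h\<close> is evaluated at the chosen later point \<open>nx c\<close>;
      as the result need not be monotone in \<open>c\<close>, it is majorized again.\<close>
    obtain f where f: "f \<in> nondecreasing_unbounded" "\<forall>\<alpha> \<beta>. \<alpha> \<le> \<beta> \<longrightarrow> h (nx \<alpha>) \<le> f \<beta>"
      using nondecreasing_majorant[of "\<lambda>\<alpha>. h (nx \<alpha>)"] by blast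
    have "bounds C f"
      unfolding bounds_def using nx h f(2) by (meson order.refl order.trans)
    then show ?thesis
      using f(1) by blast
  qed
  have step: "\<exists>D f. good D f \<and> D \<subseteq> C \<and> bounds C f" if club: "club C" for C
  proof -
    obtain f where f: "f \<in> nondecreasing_unbounded" "bounds C f"
      using majorant[OF club] by blast
    obtain D p where "club D" "p \<in> G" "UNIV - A D f \<in> fil p"
      using weakly_reasonable_complement[OF assms(3) f(1)] unfolding A_def by blast
    then have "good (C \<inter> D) f"
      unfolding good_def using club_Int[OF club] by blast
    then show ?thesis
      using f(2) by blast
  qed
  have "club (UNIV :: 'a set)"
    using exists_greater by (auto simp: club_def)
  then obtain C0 f0 where "good C0 f0"
    using step by blast
  \<comment> \<open>The function at index \<open>Suc n\<close> controls \<open>g\<close> across the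
    gaps of the club at index \<open>n\<close>; its own club is chosen only after it.\<close>
  then have "\<exists>Cf. \<forall>n. good (fst (Cf n)) (snd (Cf n)) \<and>
      (fst (Cf (Suc n)) \<subseteq> fst (Cf n) \<and> bounds (fst (Cf n)) (snd (Cf (Suc n))))"
    by (intro dependent_nat_choice) (use step in \<open>auto simp: good_def\<close>)
  then obtain Cf where Cf: "\<And>n. good (fst (Cf n)) (snd (Cf n))"
      "\<And>n. fst (Cf (Suc n)) \<subseteq> fst (Cf n)" "\<And>n. bounds (fst (Cf n)) (snd (Cf (Suc n)))"
    by blast
  define C where "C n = fst (Cf n)" for n
  define f where "f n = snd (Cf n)" for n
  have good: "good (C n) (f n)" and decr: "C (Suc n) \<subseteq> C n" and bounds: "bounds (C n) (f (Suc n))" for n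
    using Cf by (auto simp: C_def f_def)
  have C: "club (C n)" for n
    using good by (simp add: good_def)
  obtain B p where B: "\<And>n. C n \<subseteq> B n" and p: "\<And>n. p n \<in> G" "\<And>n. UNIV - A (B n) (f n) \<in> fil (p n)"
    using good unfolding good_def by metis
  have "range p \<subseteq> G" "countable (range p)"
    using p(1) by auto
  \<comment> \<open>Countably many conditions are bounded by a single \<open>q\<close>, whose filter
    contains all the complements at once.\<close>
  then obtain q where q: "q \<in> G" "\<forall>r\<in>range p. r \<le>\<^sup>0 q"
    using assms(2) unfolding countably_directed_def by blast
  have "UNIV - A (B n) (f n) \<in> fil q" for n
    using q(2) p(2) by (auto simp: le0_def)
  then obtain \<epsilon> where
    \<epsilon>: "\<And>n. \<forall>\<delta>\<in>Cl q - {..<\<epsilon> n}. (UNIV - A (B n) (f n)) \<inter> Zl q \<delta> \<in> dl q \<delta>"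
    unfolding fil_def mem_Collect_eq by metis
  have "\<exists>x. x \<in> C n" for n
    using C[of n] unfolding club_def by blast
  then obtain m where m: "\<And>n. m n \<in> C n"
    by metis
  \<comment> \<open>Countably many thresholds have a common bound below \<lambda>: beyond \<zeta>
    the block condition of every index is in force, and beyond \<mu> every \<open>C n\<close> has a
    point below \<alpha>.\<close>
  obtain \<zeta> where \<zeta>: "\<And>n. \<epsilon> n < \<zeta>"
    using sequence_bounded[of \<epsilon>] by blast
  obtain \<mu> where \<mu>: "\<And>n. m n < \<mu>"
    using sequence_bounded[of m] by blast
  have "g \<alpha> < cond_fun q \<alpha>" if \<alpha>: "max \<zeta> \<mu> < \<alpha>" for \<alpha>
  proof -
    have le: "\<epsilon> n \<le> \<alpha>" "m n \<le> \<alpha>" for n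
      using \<alpha> \<zeta>[of n] \<mu>[of n] by auto
    obtain c where c: "\<And>n. c n \<in> C n" "\<And>n. c n \<le> \<alpha>" "\<And>n x. x \<in> C n \<Longrightarrow> x \<le> \<alpha> \<Longrightarrow> x \<le> c n"
      using club_has_greatest_below[OF C m le(2)] by metis
    \<comment> \<open>\<open>c (Suc n)\<close> also lies in \<open>C n\<close>, where
      \<open>c n\<close> is the greatest point at or below \<alpha>.\<close>
    have "c (Suc n) \<le> c n" for n
      using c decr by blast
    then obtain n where n: "c (Suc n) = c n"
      using decreasing_stabilizes by blast
    obtain y where y: "y \<in> C n" "c n < y" "\<forall>\<alpha>\<le>y. g \<alpha> \<le> f (Suc n) (c n)"
      using bounds unfolding bounds_def by blast
    have "\<alpha> \<le> y"
      using c(3)[OF y(1)] y(2) by (meson leD leI less_imp_le)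
    then have "g \<alpha> \<le> f (Suc n) (c n)"
      using y by blast
    also have "f (Suc n) (c n) < cond_fun q \<alpha>"
    proof (rule less_cond_fun[OF _ \<epsilon>[of "Suc n", unfolded A_def]])
      show "q \<in> Q0"
        using q(1) assms(1) by blast
      \<comment> \<open>The coincidence is used here: \<open>f (Suc n)\<close> bounds
        \<open>g\<close> after points of \<open>C n\<close>, but \<open>q\<close> controls it on
        \<open>B (Suc n)\<close>, which contains \<open>c (Suc n)\<close>.\<close>
      show "c n \<in> B (Suc n)"
        using c(1)[of "Suc n"] B n by auto
    qed (use c le in auto)
    finally show ?thesis .
  qed
  then show "\<exists>f\<in>{cond_fun p |p. p \<in> G}. \<exists>\<alpha>. \<forall>\<beta>>\<alpha>. g \<beta> < f \<beta>"
    using q(1) by blast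
qed

end

theorem theorem4p1:
  assumes "regular_uncountable_cardinal (le_rel (UNIV :: 'a::wellorder set))"
  shows "(\<forall>G\<^sub>0 :: 'a cond set. G\<^sub>0 \<subseteq> Q0 \<and> countably_directed G\<^sub>0 \<and>
             weakly_reasonable_ultrafilter (Fil G\<^sub>0) \<longrightarrow>
             dominating {cond_fun p | p. p \<in> G\<^sub>0}) \<and>
         (\<forall>G\<^sub>1 :: 'a cond set. G\<^sub>1 \<subseteq> Q0 \<and> directed G\<^sub>1 \<and>
             weakly_reasonable_ultrafilter (Fil G\<^sub>1) \<longrightarrow>
             club_dominating {cond_fun p | p. p \<in> G\<^sub>1})"
  using dominating_cond_fun[OF assms] club_dominating_cond_fun[OF assms] by blast

end
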